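(* Let $K$ be a field and let $A\in\mathrm{GL}_n(K)$ be diagonalizable over $K$. Let $p_1,\dots,p_n$ be semi-invariant forms of degree one of $A$ with multipliers $\lambda_1,\dots,\lambda_n$, arising from $n$ linearly independent left eigenvectors of $A$ (that is, $p_i(a)=c^{(i)}a$ where $c^{(1)},\dots,c^{(n)}$ are linearly independent row vectors with $c^{(i)}A=\lambda_ic^{(i)}$). For a finite multi-subset $I$ of $\{1,\dots,n\}$ put $p_I=\prod_{i\in I}p_i$ and $\lambda_I=\prod_{i\in I}\lambda_i$. Then any semi-invariant polynomial $p$ of $A$ with multiplier $\lambda$ is of the form $$p=\sum c_I\,p_I,$$ where $I$ runs over all multi-subsets of $\{1,\dots,n\}$ with $\lambda_I=\lambda$ and $c_I\in K$ is non-zero only for finitely many $I$.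
   Context: A polynomial $p(a)=p(a_0,\dots,a_{n-1})$ with coefficients in $K$ is a semi-invariant of $A$ with multiplier $\lambda\in K$ if $p(Aa)=\lambda p(a)$, where $a$ is the column vector of the variables $a_0,\dots,a_{n-1}$. In a multi-subset, repetition of elements is allowed. *)

theory Defs
  imports "HOL-Analysis.Analysis" "HOL-Library.Poly_Mapping" "HOL-Library.Multiset"
begin

text \<open>
  The polynomial ring over \<open>'a\<close> in the variables indexed by \<open>'v\<close>: exponent vectors are
  finitely supported maps to the naturals, polynomials are finitely supported maps from
  exponent vectors to coefficients, and the multiplication of HOL-Library.Poly_Mapping is the
  convolution product.  These are formal polynomials, not polynomial functions, which matters
  over finite fields.
\<close>

type_synonym ('v, 'a) mpoly = "('v \<Rightarrow>\<^sub>0 nat) \<Rightarrow>\<^sub>0 'a"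

definition const_poly :: "'a::comm_ring_1 \<Rightarrow> ('v, 'a) mpoly" where
  "const_poly k = Poly_Mapping.single 0 k"

definition var_poly :: "'v \<Rightarrow> ('v, 'a::comm_ring_1) mpoly" where
  "var_poly i = Poly_Mapping.single (Poly_Mapping.single i 1) 1"

definition var_vec :: "('v, 'a::comm_ring_1) mpoly ^ 'v" where
  "var_vec = (\<chi> i. var_poly i)"

definition poly_subst ::
    "('v, 'a::comm_ring_1) mpoly \<Rightarrow> ('w, 'a) mpoly ^ 'v \<Rightarrow> ('w, 'a) mpoly" where
  "poly_subst p q =
    (\<Sum>m\<in>Poly_Mapping.keys p.
       const_poly (Poly_Mapping.lookup p m) *
       (\<Prod>i\<in>Poly_Mapping.keys m. (q $ i) ^ Poly_Mapping.lookup m i))"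

definition semi_invariant ::
    "'a::comm_ring_1 ^ 'v ^ 'v \<Rightarrow> 'a \<Rightarrow> ('v::finite, 'a) mpoly \<Rightarrow> bool" where
  "semi_invariant A \<mu> p \<longleftrightarrow>
    poly_subst p (map_matrix const_poly A *v var_vec) = const_poly \<mu> * p"

definition linear_form :: "'a::comm_ring_1 ^ 'v \<Rightarrow> ('v::finite, 'a) mpoly" where
  "linear_form c = (\<Sum>i\<in>UNIV. const_poly (c $ i) * var_poly i)"

definition diagonalizable :: "'a::field ^ 'n ^ 'n \<Rightarrow> bool" where
  "diagonalizable A \<longleftrightarrow>
    (\<exists>(P :: 'a ^ 'n ^ 'n) (D :: 'a ^ 'n ^ 'n). invertible P \<and> (\<forall>i j. i \<noteq> j \<longrightarrow> D $ i $ j = 0) \<and>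
       A = P ** D ** matrix_inv P)"

lemma const_poly_add: "const_poly (x + y) = const_poly x + const_poly y"
  by (simp add: const_poly_def single_add)

lemma const_poly_mult: "const_poly (x * y) = const_poly x * const_poly y"
  by (simp add: const_poly_def mult_single)

lemma const_poly_0 [simp]: "const_poly 0 = 0"
  by (simp add: const_poly_def)

lemma const_poly_sum: "const_poly (sum f S) = (\<Sum>i\<in>S. const_poly (f i))"
  by (induction S rule: infinite_finite_induct) (simp_all add: const_poly_add)

lemma lookup_linear_form:
  "Poly_Mapping.lookup (linear_form c) m =
     (\<Sum>i\<in>UNIV. if m = Poly_Mapping.single i 1 then c $ i else 0)"
  by (auto simp: linear_form_def const_poly_def var_poly_def mult_single lookup_sum
      lookup_single when_def intro!: sum.cong)

lemma single_1_eq_iff: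
  "Poly_Mapping.single i (1::nat) = Poly_Mapping.single j 1 \<longleftrightarrow> i = j"
  by (metis lookup_single_eq lookup_single_not_eq zero_neq_one)

lemma poly_subst_linear_form:
  "poly_subst (linear_form c) q = (\<Sum>i\<in>UNIV. const_poly (c $ i) * q $ i)"
proof -
  let ?s = "\<lambda>i. Poly_Mapping.single i (1::nat)"
  let ?g = "\<lambda>m. const_poly (Poly_Mapping.lookup (linear_form c) m) *
       (\<Prod>i\<in>Poly_Mapping.keys m. (q $ i) ^ Poly_Mapping.lookup m i)"
  have lk: "Poly_Mapping.lookup (linear_form c) (?s i) = c $ i" for i
    by (simp add: lookup_linear_form single_1_eq_iff[unfolded One_nat_def])
  have sub: "Poly_Mapping.keys (linear_form c) \<subseteq> range ?s"
  proof
    fix m assume "m \<in> Poly_Mapping.keys (linear_form c)"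
    then have "Poly_Mapping.lookup (linear_form c) m \<noteq> 0"
      by (rule in_keys_iff[THEN iffD1])
    then obtain i where "(if m = ?s i then c $ i else 0) \<noteq> 0"
      unfolding lookup_linear_form by (rule sum.not_neutral_contains_not_neutral)
    then show "m \<in> range ?s"
      by (auto split: if_splits)
  qed
  have "poly_subst (linear_form c) q = sum ?g (range ?s)"
    unfolding poly_subst_def using sub
    by (intro sum.mono_neutral_left) (auto simp: not_in_keys_iff_lookup_eq_zero)
  also have "\<dots> = (\<Sum>i\<in>UNIV. ?g (?s i))"
    by (subst sum.reindex) (simp_all add: inj_on_def single_1_eq_iff[unfolded One_nat_def])
  also have "\<dots> = (\<Sum>i\<in>UNIV. const_poly (c $ i) * q $ i)"
    using lk by simp
  finally show ?thesis .
qed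

text \<open>A left eigenvector yields a semi-invariant linear form with its eigenvalue as multiplier.\<close>

lemma semi_invariant_linear_form:
  assumes "c v* A = \<mu> *s c"
  shows "semi_invariant A \<mu> (linear_form c)"
proof -
  have e: "(\<Sum>i\<in>UNIV. c $ i * A $ i $ j) = \<mu> * c $ j" for j
    using arg_cong[OF assms, of "\<lambda>v. v $ j"] by (simp add: vector_matrix_mult_def)
  have "poly_subst (linear_form c) (map_matrix const_poly A *v var_vec) =
      (\<Sum>i\<in>UNIV. \<Sum>j\<in>UNIV. const_poly (c $ i * A $ i $ j) * var_poly j)"
    by (simp add: poly_subst_linear_form matrix_vector_mult_def var_vec_def const_poly_mult
        sum_distrib_left mult.assoc)
  also have "\<dots> = (\<Sum>j\<in>UNIV. const_poly (\<Sum>i\<in>UNIV. c $ i * A $ i $ j) * var_poly j)"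
    by (subst sum.swap) (simp add: const_poly_sum sum_distrib_right)
  also have "\<dots> = const_poly \<mu> * linear_form c"
    by (simp add: e linear_form_def const_poly_mult sum_distrib_left mult.assoc)
  finally show ?thesis
    by (simp add: semi_invariant_def)
qed

end

theory Submission
  imports Defs
begin

text \<open>
  Let \<open>C\<close> be the invertible matrix with rows \<open>c i\<close>.  Substituting \<open>C\<inverse> a\<close> for \<open>a\<close> turns \<open>p\<close> into a
  polynomial \<open>r\<close> with \<open>p = r(P)\<close>.  In the new coordinates \<open>A\<close> acts by \<open>a\<^sub>i \<mapsto> \<Lambda>\<^sub>i a\<^sub>i\<close>, which multiplies
  the coefficient of each monomial \<open>m\<close> of \<open>r\<close> by \<open>\<Lambda>\<^sup>m\<close>.  Comparing coefficients, semi-invariance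
  forces \<open>\<Lambda>\<^sup>m = \<mu>\<close> whenever \<open>m\<close> occurs in \<open>r\<close>.
\<close>

text \<open>The product runs over all variables and not only over the support of \<open>m\<close>,
  so that the laws for products and powers apply directly. The target monoid is left open because
  both scalars (\<open>\<Lambda>\<close>) and polynomials (\<open>P\<close>) are plugged in.\<close>

definition monom_eval :: "('v::finite \<Rightarrow> 'b::comm_monoid_mult) \<Rightarrow> ('v \<Rightarrow>\<^sub>0 nat) \<Rightarrow> 'b" where
  "monom_eval f m = (\<Prod>i\<in>UNIV. f i ^ Poly_Mapping.lookup m i)"

lemma monom_eval_0 [simp]: "monom_eval f 0 = 1"
  by (simp add: monom_eval_def)

lemma monom_eval_add: "monom_eval f (m + n) = monom_eval f m * monom_eval f n"
  by (simp add: monom_eval_def lookup_add power_add prod.distrib)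

lemma monom_eval_mult: "monom_eval (\<lambda>i. f i * g i) m = monom_eval f m * monom_eval g m"
  by (simp add: monom_eval_def power_mult_distrib prod.distrib)

lemma prod_mset_eq_monom_eval:
  assumes "\<And>i. Poly_Mapping.lookup m i = count I i"
  shows "(\<Prod>i\<in>#I. f i) = monom_eval f m"
  unfolding image_prod_mset_multiplicity monom_eval_def assms
  by (rule prod.mono_neutral_left) (auto simp: not_in_iff)

lemma poly_mapping_sum_single:
  "(\<Sum>m\<in>Poly_Mapping.keys p. Poly_Mapping.single m (Poly_Mapping.lookup p m)) = p"
  by (rule poly_mapping_eqI)
    (auto simp: lookup_sum lookup_single when_def in_keys_iff)

lemma const_poly_1 [simp]: "const_poly 1 = 1"
  by (simp add: const_poly_def)

lemma const_poly_power: "const_poly (x ^ n) = const_poly x ^ n"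
  by (induction n) (simp_all add: const_poly_mult)

lemma const_poly_prod: "const_poly (prod f S) = (\<Prod>i\<in>S. const_poly (f i))"
  by (induction S rule: infinite_finite_induct) (simp_all add: const_poly_mult)

lemma monom_eval_const_poly:
  "monom_eval (\<lambda>i. const_poly (f i)) m = const_poly (monom_eval f m)"
  by (simp add: monom_eval_def const_poly_prod const_poly_power)

lemma var_poly_power: "var_poly i ^ n = Poly_Mapping.single (Poly_Mapping.single i n) 1"
  by (induction n) (simp_all add: var_poly_def mult_single single_add [symmetric])

lemma monom_eval_var_poly: "monom_eval var_poly m = Poly_Mapping.single m 1"
proof -
  have prod_single: "(\<Prod>i\<in>S. Poly_Mapping.single (g i) 1) = Poly_Mapping.single (sum g S) 1"
    if "finite S" for g :: "'v \<Rightarrow> ('v \<Rightarrow>\<^sub>0 nat)" and S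
    using that by (induction S) (simp_all add: mult_single)
  have "(\<Sum>i\<in>UNIV. Poly_Mapping.single i (Poly_Mapping.lookup m i)) = m"
    by (rule poly_mapping_eqI) (simp add: lookup_sum lookup_single when_def)
  then show ?thesis
    by (simp add: monom_eval_def var_poly_power prod_single)
qed

text \<open>Variables outside the support of \<open>m\<close> have exponent 0 and contribute a
  factor 1.\<close>

lemma poly_subst_monom_eval:
  "poly_subst p q = (\<Sum>m\<in>Poly_Mapping.keys p.
     const_poly (Poly_Mapping.lookup p m) * monom_eval (($) q) m)"
  unfolding poly_subst_def monom_eval_def
  by (intro sum.cong arg_cong2 [of _ _ _ _ "(*)"] prod.mono_neutral_left)
    (auto simp: in_keys_iff)

lemma poly_subst_add: "poly_subst (p + p') q = poly_subst p q + poly_subst p' q"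
  unfolding poly_subst_monom_eval
  \<comment> \<open>Coefficients may cancel in \<open>p + p'\<close>, so its keys can be fewer than
    the union of the two key sets; the rule absorbs this because a zero coefficient gives a zero
    summand.\<close>
  by (rule setsum_keys_plus_distrib) (simp_all add: const_poly_add distrib_right)

lemma poly_subst_0 [simp]: "poly_subst 0 q = 0"
  by (simp add: poly_subst_def)

lemma poly_subst_sum: "poly_subst (sum f S) q = (\<Sum>x\<in>S. poly_subst (f x) q)"
  by (induction S rule: infinite_finite_induct) (simp_all add: poly_subst_add)

lemma poly_subst_single:
  "poly_subst (Poly_Mapping.single m k) q = const_poly k * monom_eval (($) q) m"
  by (simp add: poly_subst_monom_eval)

lemma poly_subst_const_poly [simp]: "poly_subst (const_poly k) q = const_poly k"
  unfolding const_poly_def [of k] poly_subst_single by (simp add: const_poly_def)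

lemma poly_subst_1 [simp]: "poly_subst 1 q = 1"
  using poly_subst_const_poly [of 1 q] by simp

text \<open>By additivity it suffices to multiply single monomials, where exponents add and
  \<open>monom_eval_add\<close> applies.\<close>

lemma poly_subst_mult: "poly_subst (p * p') q = poly_subst p q * poly_subst p' q"
proof -
  let ?s = "\<lambda>p m. Poly_Mapping.single m (Poly_Mapping.lookup p m)"
  have "poly_subst (p * p') q =
      poly_subst (sum (?s p) (Poly_Mapping.keys p) * sum (?s p') (Poly_Mapping.keys p')) q"
    by (simp only: poly_mapping_sum_single)
  also have "\<dots> = (\<Sum>m\<in>Poly_Mapping.keys p. \<Sum>m'\<in>Poly_Mapping.keys p'.
      poly_subst (?s p m) q * poly_subst (?s p' m') q)"
    by (simp add: sum_product poly_subst_sum mult_single poly_subst_single const_poly_mult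
        monom_eval_add mult_ac)
  also have "\<dots> = poly_subst p q * poly_subst p' q"
    by (simp add: sum_product poly_subst_monom_eval [of p] poly_subst_monom_eval [of p']
        poly_subst_single)
  finally show ?thesis .
qed

lemma poly_subst_power: "poly_subst (p ^ n) q = poly_subst p q ^ n"
  by (induction n) (simp_all add: poly_subst_mult)

lemma poly_subst_prod: "poly_subst (prod f S) q = (\<Prod>x\<in>S. poly_subst (f x) q)"
  by (induction S rule: infinite_finite_induct) (simp_all add: poly_subst_mult)

text \<open>Substituting \<open>r\<close> is a ring homomorphism fixing constants, so it passes
  through every monomial in the components of \<open>q\<close>.\<close>

lemma poly_subst_poly_subst:
  "poly_subst (poly_subst p q) r = poly_subst p (\<chi> i. poly_subst (q $ i) r)"
  by (simp add: poly_subst_monom_eval [of p] poly_subst_sum poly_subst_mult monom_eval_def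
      poly_subst_prod poly_subst_power)

lemma poly_subst_scaled_vars:
  "poly_subst p (\<chi> i. const_poly (l i) * var_poly i) =
     (\<Sum>m\<in>Poly_Mapping.keys p. Poly_Mapping.single m (Poly_Mapping.lookup p m * monom_eval l m))"
  by (simp add: poly_subst_monom_eval vec_lambda_inverse monom_eval_mult monom_eval_const_poly
      monom_eval_var_poly)
    (simp add: const_poly_def mult_single)

text \<open>Scaling the variables separately moves no monomial, so no two terms merge. This is what
  makes the comparison of coefficients possible.\<close>

lemma lookup_poly_subst_scaled_vars:
  "Poly_Mapping.lookup (poly_subst p (\<chi> i. const_poly (l i) * var_poly i)) m =
     Poly_Mapping.lookup p m * monom_eval l m"
  by (auto simp: poly_subst_scaled_vars lookup_sum lookup_single when_def in_keys_iff)

lemma poly_subst_var_vec: "poly_subst p var_vec = p"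
proof (rule poly_mapping_eqI)
  show "Poly_Mapping.lookup (poly_subst p var_vec) m = Poly_Mapping.lookup p m" for m
    \<comment> \<open>\<open>var_vec\<close> is the case where all scaling factors are 1.\<close>
    using lookup_poly_subst_scaled_vars [of p "\<lambda>_. 1" m]
    by (simp add: var_vec_def monom_eval_def)
qed

lemma lookup_const_poly_mult:
  "Poly_Mapping.lookup (const_poly k * p) m = k * Poly_Mapping.lookup p m"
proof -
  have "const_poly k * p =
      const_poly k * (\<Sum>m\<in>Poly_Mapping.keys p. Poly_Mapping.single m (Poly_Mapping.lookup p m))"
    by (simp only: poly_mapping_sum_single)
  also have "\<dots> = (\<Sum>m\<in>Poly_Mapping.keys p. Poly_Mapping.single m (k * Poly_Mapping.lookup p m))"
    by (simp add: sum_distrib_left const_poly_def mult_single)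
  finally show ?thesis
    by (auto simp: lookup_sum lookup_single when_def in_keys_iff)
qed

lemma linear_form_mat_1 [simp]: "linear_form (mat 1 $ i) = var_poly i"
  by (simp add: linear_form_def mat_def if_distrib [of const_poly]
      if_distrib [of "\<lambda>x. x * _"] cong: if_cong)

lemma linear_form_scale: "linear_form (k *s c) = const_poly k * linear_form c"
  by (simp add: linear_form_def const_poly_mult sum_distrib_left mult.assoc)

lemma map_matrix_mult_var_vec:
  "map_matrix const_poly M *v var_vec = (\<chi> i. linear_form (M $ i))"
  by (simp add: vec_eq_iff matrix_vector_mult_def var_vec_def linear_form_def)

text \<open>This is associativity, c(Ma) = (cM)a, read in formal polynomials; it turns composed
  linear substitutions into matrix products.\<close>

lemma poly_subst_linear_form_rows:
  "poly_subst (linear_form c) (\<chi> i. linear_form (M $ i)) = linear_form (c v* M)"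
proof -
  have "poly_subst (linear_form c) (\<chi> i. linear_form (M $ i)) =
      (\<Sum>i\<in>UNIV. \<Sum>j\<in>UNIV. const_poly (c $ i * M $ i $ j) * var_poly j)"
    by (simp add: poly_subst_linear_form)
      (simp add: linear_form_def const_poly_mult sum_distrib_left mult.assoc)
  also have "\<dots> = linear_form (c v* M)"
    by (subst sum.swap)
      (simp add: linear_form_def vector_matrix_mult_def const_poly_sum sum_distrib_right)
  finally show ?thesis .
qed

lemma matrix_matrix_mult_row: "(M ** N) $ i = M $ i v* N"
  by (simp add: matrix_matrix_mult_def vector_matrix_mult_def vec_eq_iff)

lemma invertible_independent_rows:
  fixes c :: "'n::finite \<Rightarrow> 'a::field ^ 'n"
  assumes "inj c" and "vec.independent (range c)"
  shows "invertible (\<chi> i. c i)"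
  unfolding invertible_right_inverse matrix_right_invertible_independent_rows
proof (intro allI impI)
  fix u i
  assume "(\<Sum>i\<in>UNIV. u i *s row i (\<chi> i. c i)) = 0"
  \<comment> \<open>Independence concerns the set \<open>range c\<close>, so the relation between
    the indexed rows is moved to that set; injectivity lets each vector carry the coefficient of its
    unique index.\<close>
  then have "(\<Sum>v\<in>range c. u (inv c v) *s v) = 0"
    by (simp add: sum.reindex [OF \<open>inj c\<close>] row_def inv_f_f [OF \<open>inj c\<close>] o_def)
  then have "u (inv c (c i)) = 0"
    using assms(2) vec.independentD [of "range c" "range c" "\<lambda>v. u (inv c v)" "c i"] by simp
  then show "u i = 0"
    by (simp add: inv_f_f [OF \<open>inj c\<close>])
qed

theorem theorem1p1:
  fixes A :: "'a::field ^ 'n ^ 'n"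
    and c :: "'n \<Rightarrow> 'a ^ 'n"
    and \<Lambda> :: "'n \<Rightarrow> 'a"
    and P :: "'n \<Rightarrow> ('n, 'a) mpoly"
    and \<mu> :: 'a
    and p :: "('n, 'a) mpoly"
  assumes "invertible A"
    and "diagonalizable A"
    and "inj c" and "vec.independent (range c)"
    and "\<And>i. c i v* A = \<Lambda> i *s c i"
    and "\<And>i. P i = linear_form (c i)"
    and "semi_invariant A \<mu> p"
  shows "\<exists>coef :: 'n multiset \<Rightarrow> 'a.
           finite {I. coef I \<noteq> 0} \<and>
           (\<forall>I. coef I \<noteq> 0 \<longrightarrow> (\<Prod>i\<in>#I. \<Lambda> i) = \<mu>) \<and>
           p = (\<Sum>I | coef I \<noteq> 0. const_poly (coef I) * (\<Prod>i\<in>#I. P i))"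
proof -
  define C :: "'a ^ 'n ^ 'n" where "C = (\<chi> i. c i)"
  have "invertible C"
    unfolding C_def using assms(3,4) by (rule invertible_independent_rows)
  then obtain B where CB: "C ** B = mat 1" and BC: "B ** C = mat 1"
    unfolding invertible_def by blast
  \<comment> \<open>\<open>S M q\<close> is q(Ma). Composition reverses the order:
    \<open>S N (S M q)\<close> is q(MNa).\<close>
  define S :: "'a ^ 'n ^ 'n \<Rightarrow> ('n, 'a) mpoly \<Rightarrow> ('n, 'a) mpoly" where
    "S M q = poly_subst q (\<chi> i. linear_form (M $ i))" for M q
  have S_inverse: "S N (S M q) = q" if "M ** N = mat 1" for M N q
    using poly_subst_var_vec [of q]
    by (simp add: S_def poly_subst_poly_subst poly_subst_linear_form_rows
        that var_vec_def flip: matrix_matrix_mult_row)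
  define r where "r = S B p"
  have p: "p = S C r"
    by (simp add: r_def S_inverse [OF BC])
  have "S A p = const_poly \<mu> * p"
    using assms(7) by (simp add: semi_invariant_def map_matrix_mult_var_vec S_def)
  \<comment> \<open>Semi-invariance is rewritten in the new coordinates by applying
    \<open>S B\<close> to both sides; the right-hand side is r(CABa).\<close>
  then have "const_poly \<mu> * r = S B (S A (S C r))"
    by (simp add: r_def S_inverse [OF BC]) (simp add: S_def poly_subst_mult)
  \<comment> \<open>The rows of \<open>C\<close> are left eigenvectors, so component i of CAa is
    \<open>\<Lambda> i\<close> times component i of Ca.\<close>
  also have "S A (S C r) = poly_subst r (\<chi> i. const_poly (\<Lambda> i) * linear_form (C $ i))"
    by (simp add: S_def poly_subst_poly_subst poly_subst_linear_form_rows C_def assms(5)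
        linear_form_scale)
  also have "S B \<dots> = poly_subst r (\<chi> i. const_poly (\<Lambda> i) * var_poly i)"
    by (simp add: S_def poly_subst_poly_subst poly_subst_mult poly_subst_linear_form_rows CB
        flip: matrix_matrix_mult_row)
  finally have "\<mu> * Poly_Mapping.lookup r m = Poly_Mapping.lookup r m * monom_eval \<Lambda> m" for m
    by (simp flip: lookup_const_poly_mult lookup_poly_subst_scaled_vars)
  then have eigen: "monom_eval \<Lambda> m = \<mu>" if "Poly_Mapping.lookup r m \<noteq> 0" for m
    using that by (metis mult.commute mult_left_cancel)

  \<comment> \<open>Multisets over \<open>'n\<close> and exponent vectors are the same data, with
    multiplicities as exponents; \<open>coef\<close> is thus the coefficient family of
    \<open>r\<close> indexed by multisets.\<close>
  define expo :: "'n multiset \<Rightarrow> 'n \<Rightarrow>\<^sub>0 nat" where "expo I = Abs_poly_mapping (count I)" for I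
  define coef where "coef I = Poly_Mapping.lookup r (expo I)" for I
  have lookup_expo: "Poly_Mapping.lookup (expo I) i = count I i" for I i
    by (simp add: expo_def)
  have "inj expo"
    by (rule injI, rule multiset_eqI) (simp flip: lookup_expo)
  moreover have "surj expo"
  proof (rule surjI, rule poly_mapping_eqI)
    show "Poly_Mapping.lookup (expo (Abs_multiset (Poly_Mapping.lookup m))) i =
        Poly_Mapping.lookup m i" for m i
      by (simp add: lookup_expo)
  qed
  ultimately have bij: "bij_betw expo {I. coef I \<noteq> 0} (Poly_Mapping.keys r)"
    by (auto simp: bij_betw_def coef_def in_keys_iff inj_on_def surj_def image_iff) metis
  have "finite {I. coef I \<noteq> 0}"
    using bij_betw_finite [OF bij] by simp
  moreover have "(\<Prod>i\<in>#I. \<Lambda> i) = \<mu>" if "coef I \<noteq> 0" for I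
    using that by (simp add: prod_mset_eq_monom_eval [OF lookup_expo] coef_def eigen)
  moreover have "p = (\<Sum>I | coef I \<noteq> 0. const_poly (coef I) * (\<Prod>i\<in>#I. P i))"
  proof -
    \<comment> \<open>Hence p = r(P): expanding \<open>r\<close> in monomials gives products of the
      \<open>P i\<close>, and the bijection \<open>expo\<close> turns the sum over monomials into
      one over multisets.\<close>
    have "($) (\<chi> i. linear_form (C $ i)) = P"
      by (simp add: C_def assms(6) fun_eq_iff)
    then have "p = (\<Sum>m\<in>Poly_Mapping.keys r.
        const_poly (Poly_Mapping.lookup r m) * monom_eval P m)"
      by (simp add: p S_def poly_subst_monom_eval)
    also have "\<dots> = (\<Sum>I | coef I \<noteq> 0. const_poly (coef I) * (\<Prod>i\<in>#I. P i))"
      by (simp add: prod_mset_eq_monom_eval [OF lookup_expo] coef_def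
          flip: sum.reindex_bij_betw [OF bij])
    finally show ?thesis .
  qed
  ultimately show ?thesis
    by blast
qed

end
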